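(* A finite simple graph $G$ is matrogenic if and only if for every alternating 4-cycle $\langle a,b:c,d\rangle$ in $G$, the map $V(G)\to V(G)$ that exchanges $a$ and $c$, exchanges $b$ and $d$, and fixes every other vertex is an automorphism of $G$.
   Context: An alternating 4-cycle $\langle a,b:c,d\rangle$ in $G$ consists of four distinct vertices with $ab,cd\in E(G)$ and $bc,ad\notin E(G)$. A graph $G$ is matrogenic if the vertex sets of the alternating 4-cycles of $G$ form the set of circuits of a matroid on $V(G)$; it is known (Földes–Hammer) that equivalently, $G$ contains no alternating 4-cycle $\langle a,b:c,d\rangle$ together with a vertex $u\notin\{a,b,c,d\}$ that is adjacent to $a$ and not adjacent to $c$. *)

theory Defs
  imports "Graph_Theory.Pair_Digraph" "HOL-Combinatorics.Transposition"
begin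

text \<open>Finite simple graphs are the \<open>pair_graph\<close>s of Graph_Theory: finite, symmetric and
  loopfree, the edge \<open>uv\<close> being represented by the two arcs \<open>(u, v)\<close> and \<open>(v, u)\<close>.\<close>

definition alternating_4_cycle :: "'a pair_pre_digraph \<Rightarrow> 'a \<Rightarrow> 'a \<Rightarrow> 'a \<Rightarrow> 'a \<Rightarrow> bool" where
  "alternating_4_cycle G a b c d \<longleftrightarrow>
     {a, b, c, d} \<subseteq> pverts G \<and> distinct [a, b, c, d] \<and>
     (a, b) \<in> parcs G \<and> (c, d) \<in> parcs G \<and> (b, c) \<notin> parcs G \<and> (a, d) \<notin> parcs G"

locale matroid =
  fixes carrier :: "'a set" and indep :: "'a set \<Rightarrow> bool"
  assumes carrier_finite: "finite carrier"
    and indep_subset_carrier: "indep X \<Longrightarrow> X \<subseteq> carrier"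
    and indep_empty: "indep {}"
    and indep_subset: "indep X \<Longrightarrow> Y \<subseteq> X \<Longrightarrow> indep Y"
    and augment: "indep X \<Longrightarrow> indep Y \<Longrightarrow> card Y < card X \<Longrightarrow> \<exists>x \<in> X - Y. indep (insert x Y)"

definition circuit :: "'a set \<Rightarrow> ('a set \<Rightarrow> bool) \<Rightarrow> 'a set \<Rightarrow> bool" where
  "circuit carrier indep C \<longleftrightarrow>
     C \<subseteq> carrier \<and> \<not> indep C \<and> (\<forall>D. D \<subset> C \<longrightarrow> indep D)"

definition matrogenic :: "'a pair_pre_digraph \<Rightarrow> bool" where
  "matrogenic G \<longleftrightarrow>
     (\<exists>indep. matroid (pverts G) indep \<and>
        {C. circuit (pverts G) indep C} = {{a, b, c, d} | a b c d. alternating_4_cycle G a b c d})"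

definition graph_automorphism :: "'a pair_pre_digraph \<Rightarrow> ('a \<Rightarrow> 'a) \<Rightarrow> bool" where
  "graph_automorphism G f \<longleftrightarrow>
     bij_betw f (pverts G) (pverts G) \<and>
     (\<forall>u \<in> pverts G. \<forall>v \<in> pverts G. (u, v) \<in> parcs G \<longleftrightarrow> (f u, f v) \<in> parcs G)"

end

theory Submission
  imports Defs
begin

text \<open>Both sides are equivalent to the absence of the configuration of Foldes and Hammer, i.e. to the
  condition that opposite vertices \<open>a\<close>, \<open>c\<close> of an alternating 4-cycle \<open>\<langle>a,b:c,d\<rangle>\<close> have the same
  neighbours outside of it. Inside the cycle the exchange of \<open>a\<close> with \<open>c\<close> and of \<open>b\<close> with \<open>d\<close>
  always preserves adjacency, so this condition says that the exchange is an automorphism.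
  If it fails at a vertex \<open>u\<close>, circuit elimination makes every 4-subset of \<open>{a, b, c, d, u}\<close> a
  circuit, but one of them contains the triangle \<open>a, b, u\<close>. Conversely, the condition yields
  weak circuit elimination by a case analysis on how two alternating 4-cycles with a common vertex
  overlap, and weak elimination suffices for a matroid.\<close>

section \<open>Matroids and their circuits\<close>

lemma matroid_of_circuits:
  fixes carrier :: "'a set" and \<C> :: "'a set set"
  assumes fin: "finite carrier"
    and sub: "\<And>C. C \<in> \<C> \<Longrightarrow> C \<subseteq> carrier"
    and nonempty: "{} \<notin> \<C>"
    and antichain: "\<And>C D. C \<in> \<C> \<Longrightarrow> D \<in> \<C> \<Longrightarrow> C \<subseteq> D \<Longrightarrow> C = D"
    and elim: "\<And>C D e. C \<in> \<C> \<Longrightarrow> D \<in> \<C> \<Longrightarrow> C \<noteq> D \<Longrightarrow> e \<in> C \<Longrightarrow> e \<in> D \<Longrightarrow>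
      \<exists>B\<in>\<C>. B \<subseteq> C \<union> D - {e}"
  defines "indep \<equiv> \<lambda>X. X \<subseteq> carrier \<and> (\<forall>C\<in>\<C>. \<not> C \<subseteq> X)"
  shows "matroid carrier indep" and "{C. circuit carrier indep C} = \<C>"
proof -
  show "matroid carrier indep"
  proof
    fix X Y assume X: "indep X" and Y: "indep Y" and less: "card Y < card X"
    show "\<exists>x \<in> X - Y. indep (insert x Y)"
    proof (rule ccontr)
      assume noaug: "\<not> ?thesis"
      \<comment> \<open>Among the independent subsets of \<open>X \<union> Y\<close> larger than \<open>Y\<close>, take \<open>Z\<close> missing the fewest
        elements of \<open>Y\<close>; exchanging an element of \<open>Z - Y\<close> for one of \<open>Y - Z\<close> must create a circuit.\<close>
      define Q where "Q Z \<longleftrightarrow> Z \<subseteq> X \<union> Y \<and> indep Z \<and> card Y < card Z" for Z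
      have "Q X" using X less by (simp add: Q_def)
      then obtain Z where "Q Z" and min: "\<And>T. Q T \<Longrightarrow> card (Y - Z) \<le> card (Y - T)"
        using ex_has_least_nat[of Q X "\<lambda>T. card (Y - T)"] by blast
      then have Z: "Z \<subseteq> X \<union> Y" "indep Z" "card Y < card Z" by (auto simp: Q_def)
      have finY: "finite Y" and finZ: "finite Z"
        using Y Z(2) fin by (auto simp: indep_def intro: finite_subset)
      \<comment> \<open>Otherwise any element of \<open>Z - Y\<close> would lie in \<open>X\<close>
        and augment \<open>Y\<close> within the independent \<open>Z\<close>.\<close>
      have "\<not> Y \<subseteq> Z"
      proof
        assume "Y \<subseteq> Z"
        moreover obtain z where "z \<in> Z" "z \<notin> Y"
          using Z(3) finY by (meson card_mono leD subsetI)
        ultimately have "z \<in> X - Y" "insert z Y \<subseteq> Z" using Z(1) by auto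
        moreover from this have "indep (insert z Y)"
          using Z(2) unfolding indep_def by (meson order_trans)
        ultimately show False using noaug by blast
      qed
      then obtain e where e: "e \<in> Y" "e \<notin> Z" by blast
      have ex: "\<exists>C\<in>\<C>. C \<subseteq> insert e Z - {f} \<and> e \<in> C" if f: "f \<in> Z - Y" for f
      proof -
        let ?T = "insert e Z - {f}"
        have "card ?T = card Z" using e f finZ by (auto simp: card_insert_if)
        moreover have "Y - ?T \<subset> Y - Z" using e f by auto
        then have "card (Y - ?T) < card (Y - Z)" using finY by (simp add: psubset_card_mono)
        ultimately have "\<not> indep ?T" using min[of ?T] Z e by (auto simp: Q_def)
        moreover have "?T \<subseteq> carrier" using Y Z(2) e by (auto simp: indep_def)
        ultimately obtain C where C: "C \<in> \<C>" "C \<subseteq> ?T" by (auto simp: indep_def)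
        moreover have "\<not> C \<subseteq> Z" using C(1) Z(2) by (auto simp: indep_def)
        ultimately show ?thesis by blast
      qed
      obtain g where g: "g \<in> Z - Y" using Z(3) finY by (meson DiffI card_mono leD subsetI)
      obtain C where C: "C \<in> \<C>" "C \<subseteq> insert e Z - {g}" "e \<in> C" using ex[OF g] by blast
      \<comment> \<open>Removing an element \<open>h\<close> of \<open>C\<close> instead of
        \<open>g\<close> yields a circuit \<open>D\<close> through \<open>e\<close> that avoids
        \<open>h\<close> and so differs from \<open>C\<close>. Both lie in
        \<open>insert e Z\<close>, hence eliminating \<open>e\<close> puts a circuit inside the
        independent \<open>Z\<close>.\<close>
      have "\<not> C \<subseteq> Y" using C(1) Y by (auto simp: indep_def)
      then obtain h where h: "h \<in> C" "h \<in> Z - Y" using C(2) e(1) by blast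
      obtain D where D: "D \<in> \<C>" "D \<subseteq> insert e Z - {h}" "e \<in> D" using ex[OF h(2)] by blast
      have "C \<noteq> D" using h D(2) by blast
      then obtain B where "B \<in> \<C>" "B \<subseteq> C \<union> D - {e}" using elim C D by meson
      moreover from this have "B \<subseteq> Z" using C(2) D(2) by blast
      ultimately show False using Z(2) by (auto simp: indep_def)
    qed
  next
    fix X Y assume "indep X" "Y \<subseteq> X"
    then show "indep Y" unfolding indep_def by (meson order_trans)
  qed (use fin nonempty in \<open>auto simp: indep_def\<close>)
  show "{C. circuit carrier indep C} = \<C>"
  proof (intro set_eqI iffI)
    fix C assume "C \<in> {C. circuit carrier indep C}"
    then have C: "C \<subseteq> carrier" "\<not> indep C" "\<And>D. D \<subset> C \<Longrightarrow> indep D"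
      by (auto simp: circuit_def)
    then obtain D where "D \<in> \<C>" "D \<subseteq> C" by (auto simp: indep_def)
    moreover from this have "\<not> indep D" by (auto simp: indep_def)
    ultimately show "C \<in> \<C>" using C(3) by blast
  next
    fix C assume "C \<in> \<C>"
    then show "C \<in> {C. circuit carrier indep C}"
      using sub antichain by (auto simp: circuit_def indep_def) blast+
  qed
qed

lemma (in matroid) dependent_contains_circuit:
  assumes "X \<subseteq> carrier" "\<not> indep X"
  obtains C where "circuit carrier indep C" "C \<subseteq> X"
proof -
  let ?P = "\<lambda>C. C \<subseteq> X \<and> \<not> indep C"
  obtain C where C: "?P C" and min: "\<And>D. ?P D \<Longrightarrow> card C \<le> card D"
    using ex_has_least_nat[of ?P X card] assms by blast
  have "finite C" using C assms carrier_finite by (meson finite_subset)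
  then have "indep D" if "D \<subset> C" for D
    using that C min[of D] psubset_card_mono[of C D] by fastforce
  then have "circuit carrier indep C" using C assms by (auto simp: circuit_def)
  then show thesis using that C by blast
qed

section \<open>Opposite vertices of alternating 4-cycles and automorphisms\<close>

definition opposite_vertices_agree :: "'a pair_pre_digraph \<Rightarrow> bool" where
  "opposite_vertices_agree G \<longleftrightarrow>
     (\<forall>a b c d u. alternating_4_cycle G a b c d \<longrightarrow> u \<notin> {a, b, c, d} \<longrightarrow>
        (a, u) \<in> parcs G \<longrightarrow> (c, u) \<in> parcs G)"

context pair_graph
begin

lemma parcs_commute: "(u, v) \<in> parcs G \<longleftrightarrow> (v, u) \<in> parcs G"
  using arcs_symmetric by blast

lemma no_loop: "(w, w) \<notin> parcs G"
  using pair_no_loops by force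

lemma alternating_4_cycle_rotate:
  "alternating_4_cycle G a b c d \<Longrightarrow> alternating_4_cycle G c d a b"
  by (auto simp: alternating_4_cycle_def parcs_commute)

lemma alternating_4_cycle_reflect:
  "alternating_4_cycle G a b c d \<Longrightarrow> alternating_4_cycle G b a d c"
  by (auto simp: alternating_4_cycle_def parcs_commute)

text \<open>The symmetries of the cycle turn the single implication of the definition into both
  equivalences: rotation exchanges the roles of \<open>a\<close> and \<open>c\<close>, and
  reflection passes to the pair \<open>b\<close>, \<open>d\<close>.\<close>

lemma opposite_vertices_agree_iff:
  assumes "opposite_vertices_agree G" "alternating_4_cycle G a b c d" "u \<notin> {a, b, c, d}"
  shows "(a, u) \<in> parcs G \<longleftrightarrow> (c, u) \<in> parcs G" "(b, u) \<in> parcs G \<longleftrightarrow> (d, u) \<in> parcs G"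
proof -
  note cyc = assms(2) alternating_4_cycle_rotate[OF assms(2)]
  note cyc' = cyc cyc[THEN alternating_4_cycle_reflect]
  show "(a, u) \<in> parcs G \<longleftrightarrow> (c, u) \<in> parcs G" "(b, u) \<in> parcs G \<longleftrightarrow> (d, u) \<in> parcs G"
    using assms(1,3) cyc' unfolding opposite_vertices_agree_def by blast+
qed

lemma opposite_vertices_agree_iff_automorphism:
  "opposite_vertices_agree G \<longleftrightarrow>
    (\<forall>a b c d. alternating_4_cycle G a b c d \<longrightarrow>
       graph_automorphism G (transpose a c \<circ> transpose b d))"
proof (intro iffI allI impI)
  fix a b c d
  assume ag: "opposite_vertices_agree G" and cyc: "alternating_4_cycle G a b c d"
  let ?f = "transpose a c \<circ> transpose b d"
  have V: "a \<in> pverts G" "b \<in> pverts G" "c \<in> pverts G" "d \<in> pverts G"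
    and dist: "a \<noteq> b" "a \<noteq> c" "a \<noteq> d" "b \<noteq> c" "b \<noteq> d" "c \<noteq> d"
    using cyc by (auto simp: alternating_4_cycle_def)
  have f: "?f a = c" "?f b = d" "?f c = a" "?f d = b" "\<And>u. u \<notin> {a, b, c, d} \<Longrightarrow> ?f u = u"
    using dist by (auto simp: transpose_def)
  have "bij_betw ?f (pverts G) (pverts G)"
    using V by (intro bij_betw_trans[of _ _ "pverts G"]) (auto simp: bij_betw_transpose_iff)
  moreover have "(u, v) \<in> parcs G \<longleftrightarrow> (?f u, ?f v) \<in> parcs G" for u v
  proof -
    have edges: "(a, b) \<in> parcs G" "(c, d) \<in> parcs G" "(b, c) \<notin> parcs G" "(a, d) \<notin> parcs G"
      using cyc by (auto simp: alternating_4_cycle_def)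
    note agree = opposite_vertices_agree_iff[OF ag cyc]
    consider "u \<notin> {a, b, c, d}" "v \<notin> {a, b, c, d}" | "u \<in> {a, b, c, d}" "v \<notin> {a, b, c, d}"
      | "u \<notin> {a, b, c, d}" "v \<in> {a, b, c, d}" | "u \<in> {a, b, c, d}" "v \<in> {a, b, c, d}" by blast
    then show ?thesis
    proof cases
      case 1
      then show ?thesis using f(5) by presburger
    next
      case 2
      then show ?thesis using f agree[of v] by (metis insertE empty_iff)
    next
      case 3
      then show ?thesis using f agree[of u] parcs_commute by (metis insertE empty_iff)
    next
      case 4
      \<comment> \<open>The exchange swaps the edges \<open>ab\<close> and \<open>cd\<close>, swaps
        the non-edges \<open>bc\<close> and \<open>da\<close>, and maps each diagonal
        \<open>ac\<close>, \<open>bd\<close> to itself.\<close>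
      then show ?thesis
        by (elim insertE emptyE) (simp_all only: f edges no_loop parcs_commute[of _ a]
            parcs_commute[of d] parcs_commute[of c b])
    qed
  qed
  ultimately show "graph_automorphism G ?f"
    by (auto simp: graph_automorphism_def)
next
  assume aut: "\<forall>a b c d. alternating_4_cycle G a b c d \<longrightarrow>
       graph_automorphism G (transpose a c \<circ> transpose b d)"
  show "opposite_vertices_agree G"
    unfolding opposite_vertices_agree_def
  proof (intro allI impI)
    fix a b c d u
    assume cyc: "alternating_4_cycle G a b c d" and u: "u \<notin> {a, b, c, d}" "(a, u) \<in> parcs G"
    have "u \<in> pverts G" using arc_snd_in_verts[OF u(2)] by simp
    moreover have "a \<in> pverts G" "a \<noteq> b" "a \<noteq> d" using cyc by (auto simp: alternating_4_cycle_def)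
    \<comment> \<open>The exchange sends \<open>a\<close> to \<open>c\<close> and fixes
      \<open>u\<close>, so it carries the edge \<open>au\<close> to \<open>cu\<close>.\<close>
    ultimately show "(c, u) \<in> parcs G"
      using aut[rule_format, OF cyc] u by (auto simp: graph_automorphism_def transpose_def)
  qed
qed

section \<open>From circuits to agreement of opposite vertices\<close>

lemma alternating_4_cycle_triangle_free:
  assumes "alternating_4_cycle G p q r s" "{x, y, z} \<subseteq> {p, q, r, s}"
    "(x, y) \<in> parcs G" "(y, z) \<in> parcs G"
  shows "(x, z) \<notin> parcs G"
  using assms by (auto simp: alternating_4_cycle_def parcs_commute no_loop)

text \<open>Any three vertices of an alternating 4-cycle include two consecutive sides, one an edge
  and one a non-edge. Hence they span neither a triangle, as above, nor an independent set.\<close>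

lemma alternating_4_cycle_opposite_edge:
  assumes "alternating_4_cycle G p q r s" "{x, y, z} \<subseteq> {p, q, r, s}" "distinct [x, y, z]"
    "(x, y) \<notin> parcs G" "(x, z) \<notin> parcs G"
  shows "(y, z) \<in> parcs G"
  using assms by (auto simp: alternating_4_cycle_def parcs_commute)

text \<open>If \<open>u\<close> separates \<open>a\<close> from \<open>c\<close>, then \<open>\<langle>a,u:c,d\<rangle>\<close> is a second alternating 4-cycle, and
  augmenting \<open>{a, c, d}\<close> shows that every 4-subset of \<open>{a, b, c, d, u}\<close> is a circuit.\<close>

lemma matrogenic_imp_opposite_vertices_agree:
  assumes "matrogenic G"
  shows "opposite_vertices_agree G"
  unfolding opposite_vertices_agree_def
proof (intro allI impI, rule ccontr)
  fix a b c d u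
  assume cyc: "alternating_4_cycle G a b c d" and u: "u \<notin> {a, b, c, d}" "(a, u) \<in> parcs G"
    and nu: "(c, u) \<notin> parcs G"
  obtain indep where "matroid (pverts G) indep"
    and "{C. circuit (pverts G) indep C} =
      {{a, b, c, d} | a b c d. alternating_4_cycle G a b c d}"
    using assms unfolding matrogenic_def by (elim exE conjE)
  then have circ: "circuit (pverts G) indep C \<longleftrightarrow>
      (\<exists>a b c d. C = {a, b, c, d} \<and> alternating_4_cycle G a b c d)" for C
    by (simp add: set_eq_iff)
  interpret M: matroid "pverts G" indep by fact
  have cyc2: "alternating_4_cycle G a u c d"
    using cyc u nu arc_snd_in_verts[OF u(2)] by (auto simp: alternating_4_cycle_def parcs_commute)
  have V: "{a, b, c, d, u} \<subseteq> pverts G" and dist: "distinct [a, b, c, d, u]"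
    using cyc cyc2 u by (auto simp: alternating_4_cycle_def)
  have C1: "circuit (pverts G) indep {a, b, c, d}" and C2: "circuit (pverts G) indep {a, u, c, d}"
    using circ cyc cyc2 by blast+
  have "{a, c, d} \<subset> {a, b, c, d}" using dist by auto
  then have acd: "indep {a, c, d}" using C1 unfolding circuit_def by blast
  have all: "\<exists>p q r s. J = {p, q, r, s} \<and> alternating_4_cycle G p q r s"
    if J: "J \<subseteq> {a, b, c, d, u}" "card J = 4" for J
  proof -
    \<comment> \<open>An independent \<open>J\<close> could only augment \<open>{a, c, d}\<close> by
      \<open>b\<close> or \<open>u\<close>, and both results are circuits.\<close>
    have "\<not> indep J"
    proof
      assume "indep J"
      moreover have "card {a, c, d} = 3" using dist by simp
      ultimately obtain x where x: "x \<in> J - {a, c, d}" "indep (insert x {a, c, d})"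
        using M.augment[OF _ acd] J(2) by fastforce
      then have "x = b \<or> x = u" using J(1) by blast
      moreover have "{a, b, c, d} = insert b {a, c, d}" "{a, u, c, d} = insert u {a, c, d}" by auto
      ultimately show False using x(2) C1 C2 by (auto simp: circuit_def)
    qed
    then obtain C where C: "circuit (pverts G) indep C" "C \<subseteq> J"
      by (rule M.dependent_contains_circuit[OF order_trans[OF J(1) V]])
    from C(1) obtain p q r s where pq: "C = {p, q, r, s}" "alternating_4_cycle G p q r s"
      unfolding circ by (elim exE conjE)
    then have "card C = 4" by (auto simp: alternating_4_cycle_def)
    moreover have "finite J" using J(2) card.infinite by fastforce
    ultimately have "C = J" using C(2) J(2) card_subset_eq by metis
    then show ?thesis using pq by blast
  qed
  \<comment> \<open>Here \<open>c\<close> is adjacent to neither \<open>b\<close> nor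
    \<open>u\<close>, which forces the edge \<open>bu\<close>. It completes the triangle
    \<open>a\<close>, \<open>b\<close>, \<open>u\<close> inside the circuit
    \<open>{a, b, d, u}\<close>.\<close>
  obtain p q r s where "{b, c, d, u} = {p, q, r, s}" "alternating_4_cycle G p q r s"
    using all[of "{b, c, d, u}"] dist by auto
  moreover have "(b, c) \<notin> parcs G" using cyc by (simp add: alternating_4_cycle_def)
  ultimately have "(b, u) \<in> parcs G"
    using alternating_4_cycle_opposite_edge[of p q r s c b u] nu dist by (auto simp: parcs_commute)
  moreover obtain p q r s where "{a, b, d, u} = {p, q, r, s}" "alternating_4_cycle G p q r s"
    using all[of "{a, b, d, u}"] dist by auto
  moreover have "(a, b) \<in> parcs G" using cyc by (simp add: alternating_4_cycle_def)
  ultimately show False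
    using alternating_4_cycle_triangle_free[of p q r s a b u] u(2) dist by auto
qed

section \<open>From agreement of opposite vertices to circuit elimination\<close>

lemma alternating_4_cycle_elimination:
  assumes ag: "opposite_vertices_agree G"
    and cyc1: "alternating_4_cycle G a b c d" and cyc2: "alternating_4_cycle G a x y z"
    and neq: "{a, b, c, d} \<noteq> {a, x, y, z}"
  shows "\<exists>p q r s. alternating_4_cycle G p q r s \<and> {p, q, r, s} \<subseteq> {b, c, d, x, y, z}"
proof -
  define E where "E u v \<longleftrightarrow> (u, v) \<in> parcs G" for u v
  have sym: "E u v \<longleftrightarrow> E v u" for u v
    by (simp add: E_def parcs_commute)
  have d1: "distinct [a, b, c, d]" "E a b" "E c d" "\<not> E b c" "\<not> E a d"
    and d2: "distinct [a, x, y, z]" "E a x" "E y z" "\<not> E x y" "\<not> E a z"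
    using cyc1 cyc2 by (auto simp: alternating_4_cycle_def E_def)
  have agree1: "u \<in> {a, b, c, d} \<or> (E a u \<longleftrightarrow> E c u) \<and> (E b u \<longleftrightarrow> E d u)" for u
    using opposite_vertices_agree_iff[OF ag cyc1] unfolding E_def by blast
  have agree2: "u \<in> {a, x, y, z} \<or> (E a u \<longleftrightarrow> E y u) \<and> (E x u \<longleftrightarrow> E z u)" for u
    using opposite_vertices_agree_iff[OF ag cyc2] unfolding E_def by blast
  \<comment> \<open>\<open>A\<close> is \<open>alternating_4_cycle\<close> without membership in
    \<open>pverts G\<close>, so the case analysis concerns only equality and adjacency of at most
    seven vertices.\<close>
  define A where "A p q r s \<longleftrightarrow>
    distinct [p, q, r, s] \<and> E p q \<and> E r s \<and> \<not> E q r \<and> \<not> E p s" for p q r s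
  \<comment> \<open>The first two cycles arise when the given ones meet in two vertices, and the other four (or one
    of the first two) when the given ones lie in a common 5-cycle; no other overlap is consistent.\<close>
  have "A c d y z \<or> A c x y b \<or> A c d b y \<or> A b d y c \<or> A c d b z \<or> A x c b d"
    using d1 d2 neq agree1[of x] agree1[of y] agree1[of z] agree2[of b] agree2[of c] agree2[of d]
      sym[of b c] sym[of b d] sym[of c d] sym[of x y] sym[of x z] sym[of y z]
      sym[of b x] sym[of b y] sym[of b z] sym[of c x] sym[of c y] sym[of c z]
      sym[of d x] sym[of d y] sym[of d z]
    unfolding A_def
    by (smt (verit) distinct_length_2_or_more distinct_singleton insert_iff empty_iff
        insert_commute)
  moreover have cycle: ?thesis if pqrs: "A p q r s" "{p, q, r, s} \<subseteq> {b, c, d, x, y, z}" for p q r s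
  proof -
    have "{b, c, d, x, y, z} \<subseteq> pverts G"
      using cyc1 cyc2 by (simp add: alternating_4_cycle_def)
    with pqrs(2) have "{p, q, r, s} \<subseteq> pverts G" by (rule order_trans)
    then have "alternating_4_cycle G p q r s"
      using pqrs(1) by (simp add: alternating_4_cycle_def A_def E_def)
    then show ?thesis using pqrs(2) by (intro exI conjI)
  qed
  ultimately show ?thesis
    by (elim disjE) (erule cycle; simp)+
qed

lemma opposite_vertices_agree_imp_matrogenic:
  assumes ag: "opposite_vertices_agree G"
  shows "matrogenic G"
proof -
  let ?\<C> = "{{a, b, c, d} | a b c d. alternating_4_cycle G a b c d}"
  have card4: "finite C \<and> card C = 4 \<and> C \<subseteq> pverts G" if "C \<in> ?\<C>" for C
    using that by (auto simp: alternating_4_cycle_def)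
  \<comment> \<open>The symmetries of the cycle bring any of its vertices to the front, so two
    circuits sharing \<open>e\<close> can both be written starting at \<open>e\<close>.\<close>
  have start: "\<exists>b c d. C = {e, b, c, d} \<and> alternating_4_cycle G e b c d"
    if C: "C \<in> ?\<C>" and e: "e \<in> C" for C e
  proof -
    obtain a b c d where Ceq: "C = {a, b, c, d}" and cyc: "alternating_4_cycle G a b c d"
      using C by blast
    note cyc = cyc alternating_4_cycle_rotate[OF cyc]
    note cyc' = cyc cyc[THEN alternating_4_cycle_reflect]
    have "C = {b, a, d, c}" "C = {c, d, a, b}" "C = {d, c, b, a}" using Ceq by auto
    then show ?thesis using Ceq cyc' e by blast
  qed
  have sub: "C \<subseteq> pverts G" if "C \<in> ?\<C>" for C
    using card4[OF that] by blast
  have nonempty: "{} \<notin> ?\<C>" using card4[of "{}"] by fastforce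
  have antichain: "C = D" if "C \<in> ?\<C>" "D \<in> ?\<C>" "C \<subseteq> D" for C D
    using card4[OF that(1)] card4[OF that(2)] that(3) by (metis card_subset_eq)
  have elim: "\<exists>B\<in>?\<C>. B \<subseteq> C \<union> D - {e}"
    if CD: "C \<in> ?\<C>" "D \<in> ?\<C>" and "C \<noteq> D" "e \<in> C" "e \<in> D" for C D e
  proof -
    obtain b c d where C: "C = {e, b, c, d}" "alternating_4_cycle G e b c d"
      using start CD(1) \<open>e \<in> C\<close> by blast
    obtain x y z where D: "D = {e, x, y, z}" "alternating_4_cycle G e x y z"
      using start CD(2) \<open>e \<in> D\<close> by blast
    obtain p q r s where B: "alternating_4_cycle G p q r s" "{p, q, r, s} \<subseteq> {b, c, d, x, y, z}"
      using alternating_4_cycle_elimination[OF ag C(2) D(2) \<open>C \<noteq> D\<close>[unfolded C(1) D(1)]]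
      by (elim exE conjE)
    have "e \<notin> {b, c, d, x, y, z}" using C(2) D(2) by (auto simp: alternating_4_cycle_def)
    then have "{p, q, r, s} \<subseteq> C \<union> D - {e}" using B(2) unfolding C D by blast
    then show ?thesis using B(1) by blast
  qed
  let ?indep = "\<lambda>X. X \<subseteq> pverts G \<and> (\<forall>C\<in>?\<C>. \<not> C \<subseteq> X)"
  have "matroid (pverts G) ?indep" "{C. circuit (pverts G) ?indep C} = ?\<C>"
    by (rule matroid_of_circuits[OF pair_finite_verts]; fact sub nonempty antichain elim)+
  then show ?thesis
    unfolding matrogenic_def by (intro exI conjI)
qed

end

theorem theorem3p3:
  fixes G :: "'a pair_pre_digraph"
  assumes "pair_graph G"
  shows "matrogenic G \<longleftrightarrow>
    (\<forall>a b c d. alternating_4_cycle G a b c d \<longrightarrow>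
       graph_automorphism G (transpose a c \<circ> transpose b d))"
proof -
  interpret pair_graph G by fact
  show ?thesis
    using matrogenic_imp_opposite_vertices_agree opposite_vertices_agree_imp_matrogenic
      opposite_vertices_agree_iff_automorphism by blast
qed

end
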